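(* Let $X$ be a complex Banach space and let $A:D(A)\subset X\to X$ and $T:D(T)\subset X\to X$ be two closed linear operators. Suppose that $A$ commutes with $T$ ($AT=TA$) and that for some $\lambda\in\rho(A)\cap\rho(T)$ the operator $(\lambda I-A)^{-1}-(\lambda I-T)^{-1}$ has a power of finite rank. Then $A$ has a purely B-discrete spectrum if and only if $T$ has a purely B-discrete spectrum.
   Context: For linear operators $A:D(A)\subset X\to X$ and $T:D(T)\subset X\to X$, $A$ commutes with $T$, written $AT=TA$, if (i) $D(A)\subset D(T)$; (ii) $Tx\in D(A)$ whenever $x\in D(A)$; (iii) $ATx=TAx$ for all $x\in D(A)$ with $Ax\in D(T)$. $\rho(\cdot)$ and $\sigma(\cdot)$ denote resolvent set and spectrum. For a closed operator $T$, write $N(T)$, $R(T)$ for its nullspace and range. Ascent: $a(T)=\inf\{n\in\mathbb N: N(T^n)=N(T^{n+1})\}$; descent: $\delta(T)=\inf\{n\in\mathbb N: R(T^n)=R(T^{n+1})\}$ (with $\inf\emptyset=\infty$, $\mathbb N=\{0,1,2,\dots\}$, and $T^n$ defined on its natural domain). $T$ is Drazin invertible if $a(T)$ and $\delta(T)$ are both finite. The Drazin spectrum is $\sigma_{D}(T)=\{\lambda\in\mathbb C: T-\lambda I\text{ is not Drazin invertible}\}$. The B-discrete spectrum is $\sigma_{bd}(T)=\sigma(T)\setminus\sigma_D(T)$, and $T$ has a purely B-discrete spectrum if $\sigma(T)=\sigma_{bd}(T)$. *)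

theory Defs
  imports "HOL-Analysis.Analysis" "HOL-Library.Extended_Nat"
begin

class complex_banach = banach +
  fixes scaleC :: "complex \<Rightarrow> 'a \<Rightarrow> 'a" (infixr \<open>*\<^sub>C\<close> 75)
  assumes scaleC_add_right: "a *\<^sub>C (x + y) = a *\<^sub>C x + a *\<^sub>C y"
    and scaleC_add_left: "(a + b) *\<^sub>C x = a *\<^sub>C x + b *\<^sub>C x"
    and scaleC_scaleC: "a *\<^sub>C b *\<^sub>C x = (a * b) *\<^sub>C x"
    and scaleC_one: "1 *\<^sub>C x = x"
    and scaleC_of_real: "complex_of_real r *\<^sub>C x = r *\<^sub>R x"
    and norm_scaleC: "norm (a *\<^sub>C x) = cmod a * norm x"

instantiation complex :: complex_banach
begin
definition scaleC_complex :: "complex \<Rightarrow> complex \<Rightarrow> complex"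
  where "scaleC_complex a x = a * x"
instance
  by standard (simp_all add: scaleC_complex_def algebra_simps norm_mult scaleR_conv_of_real)
end

global_interpretation complex_vector:
  vector_space "scaleC :: complex \<Rightarrow> 'a \<Rightarrow> 'a::complex_banach"
  by standard (simp_all add: scaleC_add_right scaleC_add_left scaleC_scaleC scaleC_one)

text \<open>The values of \<open>app T\<close> outside \<open>dom_of T\<close> are irrelevant.\<close>

datatype 'a lop = Lop (dom_of: "'a set") (app: "'a \<Rightarrow> 'a")

definition linear_op :: "'a::complex_banach lop \<Rightarrow> bool" where
  "linear_op T \<longleftrightarrow>
     complex_vector.subspace (dom_of T) \<and>
     (\<forall>x\<in>dom_of T. \<forall>y\<in>dom_of T. app T (x + y) = app T x + app T y) \<and>
     (\<forall>c. \<forall>x\<in>dom_of T. app T (c *\<^sub>C x) = c *\<^sub>C app T x)"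

definition closed_op :: "'a::complex_banach lop \<Rightarrow> bool" where
  "closed_op T \<longleftrightarrow> linear_op T \<and> closed ((\<lambda>x. (x, app T x)) ` dom_of T)"

definition commutes :: "'a::complex_banach lop \<Rightarrow> 'a lop \<Rightarrow> bool" where
  "commutes A T \<longleftrightarrow>
     dom_of A \<subseteq> dom_of T \<and>
     (\<forall>x\<in>dom_of A. app T x \<in> dom_of A) \<and>
     (\<forall>x\<in>dom_of A. app A x \<in> dom_of T \<longrightarrow> app A (app T x) = app T (app A x))"

text \<open>\<open>shift_op T c\<close> is $T - cI$, with the domain of $T$.\<close>

definition shift_op :: "'a::complex_banach lop \<Rightarrow> complex \<Rightarrow> 'a lop" where
  "shift_op T c = Lop (dom_of T) (\<lambda>x. app T x - c *\<^sub>C x)"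

primrec pow_op :: "'a::complex_banach lop \<Rightarrow> nat \<Rightarrow> 'a lop" where
  "pow_op T 0 = Lop UNIV (\<lambda>x. x)"
| "pow_op T (Suc n) =
     Lop {x \<in> dom_of (pow_op T n). app (pow_op T n) x \<in> dom_of T}
         (\<lambda>x. app T (app (pow_op T n) x))"

definition null_space :: "'a::complex_banach lop \<Rightarrow> 'a set" where
  "null_space T = {x \<in> dom_of T. app T x = 0}"

definition range_space :: "'a::complex_banach lop \<Rightarrow> 'a set" where
  "range_space T = app T ` dom_of T"

text \<open>\<open>resolvent_op c T\<close> is $(cI - T)^{-1}$; it is meaningful only for \<open>c \<in> resolvent_set T\<close>.
  Complex linearity of the inverse is inherited from $T$, so \<open>bounded_linear\<close> below adds just boundedness.\<close>

definition resolvent_op :: "complex \<Rightarrow> 'a::complex_banach lop \<Rightarrow> 'a \<Rightarrow> 'a" where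
  "resolvent_op c T = inv_into (dom_of T) (\<lambda>x. c *\<^sub>C x - app T x)"

definition resolvent_set :: "'a::complex_banach lop \<Rightarrow> complex set" where
  "resolvent_set T =
     {c. bij_betw (\<lambda>x. c *\<^sub>C x - app T x) (dom_of T) UNIV \<and> bounded_linear (resolvent_op c T)}"

definition spectrum_op :: "'a::complex_banach lop \<Rightarrow> complex set" where
  "spectrum_op T = - resolvent_set T"

text \<open>In \<^typ>\<open>enat\<close> the infimum of the empty set is \<open>\<infinity>\<close>.\<close>

definition ascent :: "'a::complex_banach lop \<Rightarrow> enat" where
  "ascent T = Inf (enat ` {n. null_space (pow_op T n) = null_space (pow_op T (Suc n))})"

definition descent :: "'a::complex_banach lop \<Rightarrow> enat" where
  "descent T = Inf (enat ` {n. range_space (pow_op T n) = range_space (pow_op T (Suc n))})"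

definition drazin_invertible :: "'a::complex_banach lop \<Rightarrow> bool" where
  "drazin_invertible T \<longleftrightarrow> ascent T \<noteq> \<infinity> \<and> descent T \<noteq> \<infinity>"

definition drazin_spectrum :: "'a::complex_banach lop \<Rightarrow> complex set" where
  "drazin_spectrum T = {c. \<not> drazin_invertible (shift_op T c)}"

definition b_discrete_spectrum :: "'a::complex_banach lop \<Rightarrow> complex set" where
  "b_discrete_spectrum T = spectrum_op T - drazin_spectrum T"

definition purely_b_discrete :: "'a::complex_banach lop \<Rightarrow> bool" where
  "purely_b_discrete T \<longleftrightarrow> spectrum_op T = b_discrete_spectrum T"

text \<open>The span is over the complex scalars; \<open>F\<close> is an everywhere defined operator.\<close>

definition finite_rank :: "('a::complex_banach \<Rightarrow> 'a) \<Rightarrow> bool" where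
  "finite_rank F \<longleftrightarrow> (\<exists>B. finite B \<and> range F \<subseteq> complex_vector.span B)"

definition has_finite_rank_power :: "('a::complex_banach \<Rightarrow> 'a) \<Rightarrow> bool" where
  "has_finite_rank_power F \<longleftrightarrow> (\<exists>n\<ge>1. finite_rank (F ^^ n))"

end

theory Submission
  imports Defs
begin

text \<open>For $\lambda \neq c$ one has $T - \lambda I = (c - \lambda)\,(R - (c - \lambda)^{-1} I)\,(c I - T)$ on
  the domain of $T$, where $R = (cI - T)^{-1}$. Hence the powers of $T - \lambda I$ have the same null
  spaces and ranges as the powers of the everywhere defined operator $R - (c - \lambda)^{-1} I$.
  Commutation of $A$ and $T$ makes the two resolvents commute, so it remains to compare commuting
  linear maps $u$ and $v$ for which $g = u - v$ has a power of finite rank. Fitting's lemma splits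
  the space into $N(g^m) \oplus R(g^m)$. The second summand is finite-dimensional, so all kernel and
  range chains of $v$ stabilize on it; on the first, $g$ is nilpotent and the binomial
  expansions of $v^n = (u - g)^n$ and $u^n = (v + g)^n$ transfer the stabilization from $u$ to $v$.
  Boundedness plays no role.\<close>

section \<open>Iterates of a self-map: stabilization of kernels and ranges\<close>

lemma funpow_commute:
  assumes "\<And>x. f (g x) = g (f x)"
  shows "(f ^^ i) ((g ^^ j) x) = (g ^^ j) ((f ^^ i) x)"
proof -
  have *: "f ((g ^^ j) x) = (g ^^ j) (f x)" for x
    by (induction j) (simp_all add: assms)
  show ?thesis
    by (induction i) (simp_all add: *)
qed

lemma funpow_image_subset:
  assumes "f ` W \<subseteq> W" "x \<in> W"
  shows "(f ^^ n) x \<in> W"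
  using assms by (induction n) auto

lemma funpow_add_apply: "(f ^^ (m + n)) x = (f ^^ m) ((f ^^ n) x)"
  by (simp add: funpow_add)

text \<open>One exponent \<open>p\<close> bounds all kernels at once, which transfers between maps
  more easily than equality of two consecutive kernels; \<open>finite_ascent_iff\<close> relates the
  two forms.\<close>

definition finite_ascent :: "('b::zero \<Rightarrow> 'b) \<Rightarrow> bool" where
  "finite_ascent f \<longleftrightarrow> (\<exists>p. \<forall>k x. (f ^^ k) x = 0 \<longrightarrow> (f ^^ p) x = 0)"

definition finite_descent :: "('b \<Rightarrow> 'b) \<Rightarrow> bool" where
  "finite_descent f \<longleftrightarrow> (\<exists>p. \<forall>k. range (f ^^ p) \<subseteq> range (f ^^ k))"

text \<open>If \<open>f ^^ (p + Suc d)\<close> kills \<open>x\<close>, then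
  \<open>(f ^^ d) x\<close> lies in \<open>W\<close> and is killed by \<open>f ^^ Suc p\<close>,
  hence by \<open>f ^^ p\<close>, so \<open>d\<close> drops by one. The invariant set
  \<open>W\<close> lets this serve both the whole space and a finite-dimensional subspace.\<close>

lemma stable_kernel:
  assumes "f ` W \<subseteq> W"
    and stable: "\<And>x. x \<in> W \<Longrightarrow> (f ^^ Suc p) x = 0 \<Longrightarrow> (f ^^ p) x = 0"
    and zero: "f 0 = 0" and "x \<in> W" "(f ^^ k) x = 0"
  shows "(f ^^ p) x = 0"
proof -
  have *: "(f ^^ p) x = 0" if "x \<in> W" "(f ^^ (p + d)) x = 0" for d x
    using that
  proof (induction d)
    case (Suc d)
    have "(f ^^ Suc p) ((f ^^ d) x) = 0"
      using Suc.prems by (simp add: funpow_add)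
    then show ?case
      using stable[of "(f ^^ d) x"] funpow_image_subset[OF assms(1)] Suc
      by (simp add: funpow_add)
  qed simp
  have "(f ^^ p) 0 = 0"
    by (induction p) (simp_all add: zero)
  \<comment> \<open>Padding the exponent to \<open>p + k\<close> avoids comparing \<open>k\<close>
    with \<open>p\<close>.\<close>
  then have "(f ^^ (p + k)) x = 0"
    using assms(5) by (simp add: funpow_add)
  then show ?thesis
    using * \<open>x \<in> W\<close> by blast
qed

text \<open>Applying \<open>f\<close> repeatedly to the assumed inclusion pushes the image of
  \<open>f ^^ p\<close> into that of \<open>f ^^ (p + d)\<close>; for \<open>d = k\<close>,
  invariance of \<open>W\<close> removes the offset \<open>p\<close>.\<close>

lemma stable_range:
  assumes "f ` W \<subseteq> W" and stable: "(f ^^ p) ` W \<subseteq> (f ^^ Suc p) ` W"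
  shows "(f ^^ p) ` W \<subseteq> (f ^^ k) ` W"
proof -
  have *: "(f ^^ p) ` W \<subseteq> (f ^^ (p + d)) ` W" for d
  proof (induction d)
    case (Suc d)
    have "(f ^^ p) ` W \<subseteq> f ` ((f ^^ p) ` W)"
      using stable by (simp add: image_comp)
    also have "\<dots> \<subseteq> f ` ((f ^^ (p + d)) ` W)"
      using Suc by (rule image_mono)
    finally show ?case
      by (simp add: image_comp)
  qed simp
  have "(f ^^ (k + p)) ` W \<subseteq> (f ^^ k) ` W"
    using funpow_image_subset[OF assms(1)] by (auto simp: funpow_add)
  then show ?thesis
    using *[of k] by (auto simp: add.commute)
qed

lemma finite_ascent_iff:
  assumes "f 0 = 0"
  shows "finite_ascent f \<longleftrightarrow> (\<exists>n. {x. (f ^^ n) x = 0} = {x. (f ^^ Suc n) x = 0})"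
proof
  assume "finite_ascent f"
  then obtain p where p: "\<And>k x. (f ^^ k) x = 0 \<Longrightarrow> (f ^^ p) x = 0"
    unfolding finite_ascent_def by blast
  have "(f ^^ p) x = 0 \<longleftrightarrow> (f ^^ Suc p) x = 0" for x
    using p[of "Suc p" x] assms by auto
  then show "\<exists>n. {x. (f ^^ n) x = 0} = {x. (f ^^ Suc n) x = 0}"
    by blast
next
  assume "\<exists>n. {x. (f ^^ n) x = 0} = {x. (f ^^ Suc n) x = 0}"
  then obtain p where "{x. (f ^^ p) x = 0} = {x. (f ^^ Suc p) x = 0}" ..
  then show "finite_ascent f"
    unfolding finite_ascent_def using stable_kernel[of f UNIV p] assms by blast
qed

lemma finite_descent_iff:
  "finite_descent f \<longleftrightarrow> (\<exists>n. range (f ^^ n) = range (f ^^ Suc n))"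
proof
  assume "finite_descent f"
  then obtain p where "\<And>k. range (f ^^ p) \<subseteq> range (f ^^ k)"
    unfolding finite_descent_def by blast
  moreover have "range (f ^^ Suc p) \<subseteq> range (f ^^ p)"
    by (auto simp only: funpow_Suc_right o_apply)
  ultimately show "\<exists>n. range (f ^^ n) = range (f ^^ Suc n)"
    by blast
next
  assume "\<exists>n. range (f ^^ n) = range (f ^^ Suc n)"
  then obtain p where "range (f ^^ p) = range (f ^^ Suc p)" ..
  then show "finite_descent f"
    unfolding finite_descent_def using stable_range[of f UNIV p] by blast
qed

section \<open>Linear self-maps and finite-dimensional invariant subspaces\<close>

abbreviation endomorphism :: "('f::field \<Rightarrow> 'b::ab_group_add \<Rightarrow> 'b) \<Rightarrow> ('b \<Rightarrow> 'b) \<Rightarrow> bool" where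
  "endomorphism s \<equiv> Vector_Spaces.linear s s"

context vector_space
begin

lemma endomorphism_iff:
  fixes f :: "'b \<Rightarrow> 'b"
  shows "endomorphism scale f \<longleftrightarrow> (\<forall>x y. f (x + y) = f x + f y) \<and> (\<forall>c x. f (scale c x) = scale c (f x))"
  using vector_space_axioms by (simp add: Vector_Spaces.linear_iff)

lemma endomorphism_0: "endomorphism scale f \<Longrightarrow> f 0 = 0"
  by (rule module_hom.zero[OF Vector_Spaces.linear.axioms(3)])

lemma endomorphism_diff: "endomorphism scale f \<Longrightarrow> f (x - y) = f x - f y"
  by (rule module_hom.diff[OF Vector_Spaces.linear.axioms(3)])

lemma endomorphism_uminus: "endomorphism scale f \<Longrightarrow> f (- x) = - f x"
  using endomorphism_diff[of f 0 x] by (simp add: endomorphism_0)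

lemma endomorphism_subspace_image: "endomorphism scale f \<Longrightarrow> subspace W \<Longrightarrow> subspace (f ` W)"
  by (rule module_hom.subspace_image[OF Vector_Spaces.linear.axioms(3)])


text \<open>Each strict inclusion supplies a vector outside the span of those chosen before, so
  \<open>N\<close> steps yield \<open>N\<close> independent vectors inside the span of
  \<open>B\<close>.\<close>

lemma subspace_chain_length:
  assumes "\<And>i. i \<le> N \<Longrightarrow> subspace (S i)"
    and "\<And>i. i < N \<Longrightarrow> S i \<subset> S (Suc i)"
    and "S N \<subseteq> span B" "finite B"
  shows "N \<le> card B"
proof -
  have "\<exists>b. independent b \<and> finite b \<and> card b = n \<and> b \<subseteq> S n" if "n \<le> N" for n
    using that
  proof (induction n)
    case 0
    then show ?case by (intro exI[of _ "{}"]) (simp add: independent_empty)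
  next
    case (Suc n)
    then obtain b where b: "independent b" "finite b" "card b = n" "b \<subseteq> S n"
      by auto
    obtain x where x: "x \<in> S (Suc n)" "x \<notin> S n"
      using assms(2)[of n] Suc.prems by auto
    have "x \<notin> span b"
      using span_minimal[OF b(4) assms(1)] Suc.prems x by auto
    then have "independent (insert x b)" "x \<notin> b"
      using b independent_insert span_base by auto
    moreover have "insert x b \<subseteq> S (Suc n)"
      using x b assms(2)[of n] Suc.prems by auto
    ultimately show ?case
      using b by (intro exI[of _ "insert x b"]) auto
  qed
  then obtain b where "independent b" "card b = N" "b \<subseteq> S N"
    by blast
  then show ?thesis
    using independent_span_bound[OF assms(4)] assms(3) by fastforce
qed

lemma endomorphism_funpow:
  assumes "endomorphism scale f"
  shows "endomorphism scale (f ^^ n)"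
  using assms by (induction n) (auto simp: endomorphism_iff)

lemma kernels_stabilize_finite_dim:
  assumes f: "endomorphism scale f"
    and W: "subspace W" "f ` W \<subseteq> W" "W \<subseteq> span B" "finite B"
  shows "\<exists>p. \<forall>k. \<forall>x\<in>W. (f ^^ k) x = 0 \<longrightarrow> (f ^^ p) x = 0"
proof -
  define S where "S i = {x \<in> W. (f ^^ i) x = 0}" for i
  have lin: "endomorphism scale (f ^^ i)" for i
    by (rule endomorphism_funpow[OF f])
  have zero: "(f ^^ i) 0 = 0" for i
    by (rule endomorphism_0[OF lin])
  have f0: "f 0 = 0"
    using zero[of 1] by simp
  have "subspace (S i)" for i
    using W(1) lin[of i] zero[of i] by (auto simp: S_def subspace_def endomorphism_iff)
  moreover have "S i \<subseteq> S (Suc i)" for i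
    using f0 by (auto simp: S_def)
  moreover have "S i \<subseteq> span B" for i
    using W by (auto simp: S_def)
  \<comment> \<open>The kernels in \<open>W\<close> increase, and \<open>card B + 1\<close> strict
    inclusions would contradict \<open>subspace_chain_length\<close>.\<close>
  ultimately obtain p where "S p = S (Suc p)"
    using subspace_chain_length[of "Suc (card B)" S B] W(4)
    by (metis Suc_n_not_le_n psubsetI)
  then have "(f ^^ p) x = 0" if "x \<in> W" "(f ^^ Suc p) x = 0" for x
    using that unfolding S_def by blast
  then have "(f ^^ p) x = 0" if "x \<in> W" "(f ^^ k) x = 0" for x k
    using stable_kernel[OF W(2) _ f0] that by blast
  then show ?thesis
    by blast
qed

lemma ranges_stabilize_finite_dim:
  assumes f: "endomorphism scale f"
    and W: "subspace W" "f ` W \<subseteq> W" "W \<subseteq> span B" "finite B"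
  shows "\<exists>p. \<forall>k. (f ^^ p) ` W \<subseteq> (f ^^ k) ` W"
proof -
  define N where "N = Suc (card B)"
  define S where "S i = (f ^^ i) ` W" for i
  have "subspace (S i)" for i
    unfolding S_def
    by (rule endomorphism_subspace_image[OF endomorphism_funpow[OF f] W(1)])
  moreover have anti: "S (Suc i) \<subseteq> S i" for i
    using W(2) unfolding S_def funpow_Suc_right by auto
  moreover have "S i \<subseteq> span B" for i
    using W(3) funpow_image_subset[OF W(2)] by (auto simp: S_def)
  moreover have "\<not> N \<le> card B"
    by (simp add: N_def)
  \<comment> \<open>The images decrease, so the chain is read backwards, from \<open>S N\<close> up
    to \<open>S 0\<close>, before its length is bounded.\<close>
  ultimately obtain i where i: "i < N" "\<not> S (N - i) \<subset> S (N - Suc i)"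
    using subspace_chain_length[of N "\<lambda>i. S (N - i)" B] W(4) by blast
  have "N - i = Suc (N - Suc i)"
    using i(1) by simp
  then have "S (N - Suc i) \<subseteq> S (Suc (N - Suc i))"
    using i(2) anti[of "N - Suc i"] by auto
  then show ?thesis
    using stable_range[OF W(2)] unfolding S_def by blast
qed

section \<open>Fitting decomposition of a map with a power of finite rank\<close>

text \<open>Inside the finite-dimensional range of \<open>f ^^ n\<close> the ranges stabilize, say
  at \<open>m\<close>. Then \<open>(f ^^ m) x = (f ^^ (m + m)) y\<close> for some \<open>y\<close>,
  so kernel and range of \<open>f ^^ m\<close> together span the space; stabilization of the kernels
  on that range makes the sum direct.\<close>

lemma fitting_decomposition:
  assumes f: "endomorphism scale f"
    and B: "range (f ^^ n) \<subseteq> span B" "finite B"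
  obtains m where "range (f ^^ m) \<subseteq> span B"
    "\<And>x. \<exists>y. (f ^^ m) (x - (f ^^ m) y) = 0"
    "\<And>x. x \<in> range (f ^^ m) \<Longrightarrow> (f ^^ m) x = 0 \<Longrightarrow> x = 0"
proof -
  have lin: "endomorphism scale (f ^^ i)" for i
    by (rule endomorphism_funpow[OF f])
  have sub: "subspace (range (f ^^ i))" for i
    by (rule endomorphism_subspace_image[OF lin subspace_UNIV])
  have inv: "f ` range (f ^^ i) \<subseteq> range (f ^^ i)" for i
    by (auto simp: funpow_swap1)
  obtain p where "\<And>k. (f ^^ p) ` range (f ^^ n) \<subseteq> (f ^^ k) ` range (f ^^ n)"
    using ranges_stabilize_finite_dim[OF f sub inv B] by blast
  moreover define m where "m = p + n"
  ultimately have "range (f ^^ m) \<subseteq> range (f ^^ (k + n))" for k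
    unfolding funpow_add image_comp m_def by blast
  \<comment> \<open>Shifting by \<open>p\<close> turns the exponent into
    \<open>k + m\<close>.\<close>
  from this[of "_ + p"] have m: "range (f ^^ m) \<subseteq> range (f ^^ (k + m))" for k
    by (simp add: m_def add.assoc)
  have fin: "range (f ^^ m) \<subseteq> span B"
    using B(1) funpow_image_subset[OF inv] by (auto simp: m_def funpow_add)
  obtain q where q: "\<And>k x. x \<in> range (f ^^ m) \<Longrightarrow> (f ^^ k) x = 0 \<Longrightarrow> (f ^^ q) x = 0"
    using kernels_stabilize_finite_dim[OF f sub inv fin B(2)] by blast
  show ?thesis
  proof
    fix x
    obtain y where "(f ^^ m) x = (f ^^ (m + m)) y"
      using m[of m] by blast
    moreover have "(f ^^ m) (x - z) = (f ^^ m) x - (f ^^ m) z" for z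
      by (rule endomorphism_diff[OF lin])
    ultimately show "\<exists>y. (f ^^ m) (x - (f ^^ m) y) = 0"
      by (auto simp: funpow_add intro!: exI[of _ y])
  next
    fix x assume x: "x \<in> range (f ^^ m)" "(f ^^ m) x = 0"
    \<comment> \<open>By stability of the range, \<open>x\<close> is \<open>f ^^ q\<close> of a
      vector in the range of \<open>f ^^ m\<close>, where the kernels have stabilized at
      \<open>q\<close>.\<close>
    then obtain z where z: "x = (f ^^ (q + m)) z"
      using m[of q] by blast
    then have "(f ^^ (m + q)) ((f ^^ m) z) = 0"
      using x by (simp add: funpow_add)
    then have "(f ^^ q) ((f ^^ m) z) = 0"
      by (rule q[OF rangeI])
    then show "x = 0"
      using z by (simp add: funpow_add)
  qed (fact fin)
qed

section \<open>Powers of a sum of commuting linear maps\<close>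

text \<open>Every monomial of degree \<open>k + m\<close> in \<open>f\<close> and \<open>g\<close>
  contains at least \<open>k\<close> factors \<open>f\<close> or at least \<open>m\<close> factors
  \<open>g\<close>, so it kills \<open>x\<close>. Binomial coefficients are avoided by peeling off
  one factor: \<open>f x\<close> fits the claim with \<open>k - 1\<close> and \<open>m\<close>, and
  \<open>g x\<close> with \<open>k\<close> and \<open>m - 1\<close>.\<close>

lemma funpow_add_eq_0:
  assumes f: "endomorphism scale f" and g: "endomorphism scale g"
    and comm: "\<And>x. f (g x) = g (f x)"
    and "(f ^^ k) x = 0" "(g ^^ m) x = 0"
  shows "((\<lambda>x. f x + g x) ^^ (k + m)) x = 0"
  using assms(4,5)
proof (induction "k + m" arbitrary: k m x)
  case 0
  then show ?case by simp
next
  case (Suc n)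
  let ?h = "\<lambda>x. f x + g x"
  have h: "endomorphism scale ?h"
    using f g by (auto simp: endomorphism_iff scale_right_distrib)
  note lin = endomorphism_funpow[OF h]
  have zero: "f 0 = 0" "g 0 = 0" "(?h ^^ i) 0 = 0" for i
    using f g lin[of i] by (auto intro: endomorphism_0)
  show ?case
  proof (cases "k = 0 \<or> m = 0")
    case True
    then show ?thesis using Suc zero by auto
  next
    case False
    then obtain k' m' where km: "k = Suc k'" "m = Suc m'"
      by (metis not0_implies_Suc)
    have "(?h ^^ (k' + m)) (f x) = 0"
    proof (rule Suc(1))
      show "n = k' + m" using Suc(2) km by simp
      show "(f ^^ k') (f x) = 0" using Suc(3) km by (simp add: funpow_swap1)
      show "(g ^^ m) (f x) = 0"
        using Suc(4) funpow_commute[of f g 1 m x] comm zero by simp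
    qed
    moreover have "(?h ^^ (k + m')) (g x) = 0"
    proof (rule Suc(1))
      show "n = k + m'" using Suc(2) km by simp
      show "(g ^^ m') (g x) = 0" using Suc(4) km by (simp add: funpow_swap1)
      show "(f ^^ k) (g x) = 0"
        using Suc(3) funpow_commute[of f g k 1 x] comm zero by simp
    qed
    ultimately have "(?h ^^ n) (f x + g x) = 0"
      using Suc(2) km lin[of n] by (auto simp: endomorphism_iff)
    then show ?thesis
      using Suc(2) by (metis comp_apply funpow_Suc_right)
  qed
qed

text \<open>Monomials with at least \<open>m\<close> factors \<open>g\<close> kill \<open>x\<close>,
  and all others contain more than \<open>k\<close> factors \<open>f\<close>. The witness
  \<open>y\<close> is a polynomial in \<open>f\<close> and \<open>g\<close> applied to
  \<open>x\<close>, so it stays in the kernel of \<open>g ^^ m\<close>; the descent argument relies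
  on this.\<close>

lemma funpow_add_in_range:
  assumes f: "endomorphism scale f" and g: "endomorphism scale g"
    and comm: "\<And>x. f (g x) = g (f x)"
    and "(g ^^ m) x = 0"
  shows "\<exists>y. (g ^^ m) y = 0 \<and> ((\<lambda>x. f x + g x) ^^ (k + m)) x = (f ^^ k) y"
  using assms(4)
proof (induction "k + m" arbitrary: k m x)
  case 0
  then show ?case by simp
next
  case (Suc n)
  let ?h = "\<lambda>x. f x + g x"
  have h: "endomorphism scale ?h"
    using f g by (auto simp: endomorphism_iff scale_right_distrib)
  have comm_h: "g (?h x) = ?h (g x)" "f (?h x) = ?h (f x)" for x
    using f g comm by (auto simp: endomorphism_iff)
  note lin = endomorphism_funpow[OF h] endomorphism_funpow[OF g] endomorphism_funpow[OF f]
  have zero: "f 0 = 0" "g 0 = 0" "(?h ^^ i) 0 = 0" "(f ^^ i) 0 = 0" for i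
    using f g lin[of i] by (auto intro: endomorphism_0)
  show ?case
  proof (cases "k = 0 \<or> m = 0")
    case True
    then show ?thesis
    proof
      assume "k = 0"
      moreover have "(g ^^ m) ((?h ^^ m) x) = (?h ^^ m) ((g ^^ m) x)"
        using comm_h(1) by (rule funpow_commute)
      ultimately show ?thesis using Suc(3) zero by auto
    next
      assume "m = 0"
      then show ?thesis using Suc(3) zero by (intro exI[of _ 0]) auto
    qed
  next
    case False
    then obtain k' m' where km: "k = Suc k'" "m = Suc m'"
      by (metis not0_implies_Suc)
    obtain y where y: "(g ^^ m) y = 0" "(?h ^^ (k' + m)) x = (f ^^ k') y"
      using Suc(1)[of k' m x] Suc(2,3) km by auto
    have "(?h ^^ (k' + m)) (f x) = f ((?h ^^ (k' + m)) x)"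
      using funpow_commute[of f ?h 1 "k' + m" x] comm_h(2) by simp
    then have 1: "(?h ^^ n) (f x) = (f ^^ k) y"
      using y Suc(2) km by simp
    have "(g ^^ m') (g x) = 0"
      using Suc(3) km by (simp add: funpow_swap1)
    then obtain z where z: "(g ^^ m') z = 0" "(?h ^^ (k + m')) (g x) = (f ^^ k) z"
      using Suc(1)[of k m' "g x"] Suc(2) km by auto
    have "(g ^^ m) (y + z) = 0"
      using y z km zero lin(2)[of m] by (simp add: endomorphism_iff)
    moreover have "(?h ^^ n) (f x + g x) = (f ^^ k) (y + z)"
      using 1 z(2) Suc(2) km lin(1)[of n] lin(3)[of k] by (simp add: endomorphism_iff)
    ultimately show ?thesis
      using Suc(2) by (metis comp_apply funpow_Suc_right)
  qed
qed

text \<open>The sign is \<open>(-1)^k\<close>; leaving it undetermined suffices for kernels and for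
  membership in spans.\<close>

lemma funpow_uminus:
  assumes "endomorphism scale g"
  shows "((\<lambda>x. - g x) ^^ k) x = (g ^^ k) x \<or> ((\<lambda>x. - g x) ^^ k) x = - (g ^^ k) x"
proof (induction k)
  case (Suc k)
  then show ?case
    using endomorphism_uminus[OF assms] by auto
qed simp

section \<open>Commuting linear maps whose difference has a power of finite rank\<close>

context
  fixes u v :: "'b \<Rightarrow> 'b" and n :: nat and B :: "'b set"
  assumes u: "endomorphism scale u" and v: "endomorphism scale v"
    and comm: "\<And>x. u (v x) = v (u x)"
    and rank: "range ((\<lambda>x. u x - v x) ^^ n) \<subseteq> span B" "finite B"
begin

text \<open>Bundles the Fitting decomposition of \<open>g = u - v\<close> with the facts shared by
  the ascent and descent arguments. Writing each map as a sum, with \<open>g\<close> or with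
  \<open>- g\<close>, lets the expansion lemmas pass in both directions.\<close>

lemma fitting_decomposition_perturbation:
  obtains g m where "endomorphism scale g" "endomorphism scale (\<lambda>x. - g x)"
    "u = (\<lambda>x. v x + g x)" "v = (\<lambda>x. u x + - g x)"
    "\<And>x. u (g x) = g (u x)" "\<And>x. v (g x) = g (v x)"
    "\<And>x. ((\<lambda>x. - g x) ^^ m) x = 0 \<longleftrightarrow> (g ^^ m) x = 0"
    "range (g ^^ m) \<subseteq> span B"
    "\<And>x. \<exists>y. (g ^^ m) (x - (g ^^ m) y) = 0"
    "\<And>x. x \<in> range (g ^^ m) \<Longrightarrow> (g ^^ m) x = 0 \<Longrightarrow> x = 0"
proof -
  define g where "g = (\<lambda>x. u x - v x)"
  have g: "endomorphism scale g" and ng: "endomorphism scale (\<lambda>x. - g x)"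
    using u v by (auto simp: endomorphism_iff g_def algebra_simps)
  have comm_g: "u (g x) = g (u x)" "v (g x) = g (v x)" for x
    using u v by (simp_all add: g_def endomorphism_diff comm)
  have eqs: "u = (\<lambda>x. v x + g x)" "v = (\<lambda>x. u x + - g x)"
    by (auto simp: g_def)
  have neg: "((\<lambda>x. - g x) ^^ k) x = 0 \<longleftrightarrow> (g ^^ k) x = 0" for k x
    using funpow_uminus[OF g, of k x] by auto
  obtain m where "range (g ^^ m) \<subseteq> span B"
    "\<And>x. \<exists>y. (g ^^ m) (x - (g ^^ m) y) = 0"
    "\<And>x. x \<in> range (g ^^ m) \<Longrightarrow> (g ^^ m) x = 0 \<Longrightarrow> x = 0"
    by (rule fitting_decomposition[OF g rank[folded g_def]]) (rule that)
  from that[OF g ng eqs comm_g neg this] show thesis .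
qed

text \<open>On the kernel of \<open>g ^^ m\<close> the bound for \<open>v\<close> comes from that
  for \<open>u\<close>; on the finite-dimensional range of \<open>g ^^ m\<close> it comes from
  dimension. As \<open>v\<close> commutes with \<open>g\<close>, it preserves both summands.\<close>

lemma finite_ascent_finite_rank_perturbation:
  assumes "finite_ascent u"
  shows "finite_ascent v"
proof -
  obtain p where p: "\<And>k x. (u ^^ k) x = 0 \<Longrightarrow> (u ^^ p) x = 0"
    using assms unfolding finite_ascent_def by blast
  obtain g m where g: "endomorphism scale g" "endomorphism scale (\<lambda>x. - g x)"
    and eqs: "u = (\<lambda>x. v x + g x)" "v = (\<lambda>x. u x + - g x)"
    and comm_g: "\<And>x. u (g x) = g (u x)" "\<And>x. v (g x) = g (v x)"
    and neg: "\<And>x. ((\<lambda>x. - g x) ^^ m) x = 0 \<longleftrightarrow> (g ^^ m) x = 0"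
    and fin: "range (g ^^ m) \<subseteq> span B"
    and ex: "\<And>x. \<exists>y. (g ^^ m) (x - (g ^^ m) y) = 0"
    and inj: "\<And>x. x \<in> range (g ^^ m) \<Longrightarrow> (g ^^ m) x = 0 \<Longrightarrow> x = 0"
    by (rule fitting_decomposition_perturbation) (rule that)
  have lin_v: "endomorphism scale (v ^^ i)" and lin_g: "endomorphism scale (g ^^ i)" for i
    using v g by (auto intro: endomorphism_funpow)
  have swap: "(v ^^ i) ((g ^^ m) x) = (g ^^ m) ((v ^^ i) x)" for i x
    using comm_g(2) by (rule funpow_commute)
  \<comment> \<open>Pass from \<open>v\<close> to \<open>u\<close> at the cost of \<open>m\<close>,
    cap the exponent at \<open>p\<close>, and return to \<open>v\<close> at the cost of another
    \<open>m\<close>.\<close>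
  have nil: "(v ^^ (p + m)) a = 0" if "(g ^^ m) a = 0" "(v ^^ k) a = 0" for a k
  proof -
    have "(u ^^ (k + m)) a = 0"
      using funpow_add_eq_0[OF v g(1) comm_g(2)] that eqs(1) by metis
    then have "(u ^^ p) a = 0"
      by (rule p)
    moreover have "u (- g x) = - g (u x)" for x
      using endomorphism_uminus[OF u] comm_g(1) by simp
    ultimately show ?thesis
      using funpow_add_eq_0[OF u g(2)] that(1) neg eqs(2) by metis
  qed
  have "v ` range (g ^^ m) \<subseteq> range (g ^^ m)"
    using swap[of 1] by auto
  then obtain q where q: "\<And>k x. x \<in> range (g ^^ m) \<Longrightarrow> (v ^^ k) x = 0 \<Longrightarrow> (v ^^ q) x = 0"
    using kernels_stabilize_finite_dim[OF v endomorphism_subspace_image[OF lin_g subspace_UNIV]]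
      fin rank(2) by metis
  \<comment> \<open>This exponent is at least \<open>p + m\<close>, good on the kernel summand, and
    at least \<open>q\<close>, good on the range summand.\<close>
  have "(v ^^ (p + m + q)) x = 0" if "(v ^^ k) x = 0" for k x
  proof -
    obtain y where y: "(g ^^ m) (x - (g ^^ m) y) = 0"
      using ex by blast
    define b where "b = (g ^^ m) y"
    \<comment> \<open>With \<open>x - b\<close> in the kernel summand and \<open>b\<close> in the
      range summand, \<open>(v ^^ k) x = 0\<close> forces both images to vanish because the sum is
      direct.\<close>
    have "(g ^^ m) ((v ^^ k) (x - b)) = 0"
      using y swap[of k "x - b"] endomorphism_0[OF lin_v] by (simp add: b_def)
    then have "(g ^^ m) ((v ^^ k) b) = 0"
      using that by (simp add: endomorphism_diff[OF lin_v] endomorphism_uminus[OF lin_g])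
    then have vb: "(v ^^ k) b = 0"
      by (rule inj[rotated]) (simp add: b_def swap)
    then have "(v ^^ k) (x - b) = 0"
      using that by (simp add: endomorphism_diff[OF lin_v])
    then have "(v ^^ (p + m)) (x - b) = 0"
      using nil y by (simp add: b_def)
    then have "(v ^^ (q + (p + m))) (x - b) = 0"
      by (simp add: funpow_add_apply[of q] endomorphism_0[OF lin_v])
    moreover have "(v ^^ q) b = 0"
      using q[of b k] vb by (simp add: b_def)
    then have "(v ^^ (p + m + q)) b = 0"
      by (simp add: funpow_add_apply[of "p + m"] endomorphism_0[OF lin_v])
    ultimately show ?thesis
      by (simp add: endomorphism_diff[OF lin_v] add.commute)
  qed
  then show ?thesis
    unfolding finite_ascent_def by blast
qed

text \<open>The splitting is the same as for ascent, but a preimage under a power of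
  \<open>u\<close> may leave the kernel of \<open>g ^^ m\<close>, so it is first replaced by its
  component there.\<close>

lemma finite_descent_finite_rank_perturbation:
  assumes "finite_descent u"
  shows "finite_descent v"
proof -
  obtain p where p: "\<And>k. range (u ^^ p) \<subseteq> range (u ^^ k)"
    using assms unfolding finite_descent_def by blast
  obtain g m where g: "endomorphism scale g" "endomorphism scale (\<lambda>x. - g x)"
    and eqs: "u = (\<lambda>x. v x + g x)" "v = (\<lambda>x. u x + - g x)"
    and comm_g: "\<And>x. u (g x) = g (u x)" "\<And>x. v (g x) = g (v x)"
    and neg: "\<And>x. ((\<lambda>x. - g x) ^^ m) x = 0 \<longleftrightarrow> (g ^^ m) x = 0"
    and fin: "range (g ^^ m) \<subseteq> span B"
    and ex: "\<And>x. \<exists>y. (g ^^ m) (x - (g ^^ m) y) = 0"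
    and inj: "\<And>x. x \<in> range (g ^^ m) \<Longrightarrow> (g ^^ m) x = 0 \<Longrightarrow> x = 0"
    by (rule fitting_decomposition_perturbation) (rule that)
  have lin_v: "endomorphism scale (v ^^ i)" and lin_g: "endomorphism scale (g ^^ i)"
    and lin_u: "endomorphism scale (u ^^ i)" for i
    using u v g by (auto intro: endomorphism_funpow)
  have swap: "(v ^^ i) ((g ^^ m) x) = (g ^^ m) ((v ^^ i) x)"
    "(u ^^ i) ((g ^^ m) x) = (g ^^ m) ((u ^^ i) x)" for i x
    using comm_g by (auto intro: funpow_commute)
  have nil: "(v ^^ (p + m)) a \<in> range (v ^^ k)" if "(g ^^ m) a = 0" for a k
  proof -
    have "u (- g x) = - g (u x)" for x
      using endomorphism_uminus[OF u] comm_g(1) by simp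
    note funpow_add_in_range[OF u g(2) this, of m a p, folded eqs(2), unfolded neg]
    then obtain b where b: "(g ^^ m) b = 0" "(v ^^ (p + m)) a = (u ^^ p) b"
      using \<open>(g ^^ m) a = 0\<close> by blast
    obtain z where z: "(u ^^ p) b = (u ^^ (k + m)) z"
      using p[of "k + m"] by blast
    obtain y where y: "(g ^^ m) (z - (g ^^ m) y) = 0"
      using ex by blast
    \<comment> \<open>\<open>c\<close> is the kernel component of the preimage \<open>z\<close>. The
      image of the other component lies in the range of \<open>g ^^ m\<close> and, as a difference
      of kernel elements, also in its kernel, so it vanishes and \<open>c\<close> is itself a
      preimage.\<close>
    define c where "c = z - (g ^^ m) y"
    have c: "(g ^^ m) c = 0"
      using y by (simp add: c_def)
    have diff: "(u ^^ (k + m)) ((g ^^ m) y) = (u ^^ p) b - (u ^^ (k + m)) c"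
      by (simp add: z c_def endomorphism_diff[OF lin_u])
    have "(g ^^ m) ((u ^^ i) w) = 0" if "(g ^^ m) w = 0" for i w
      using that swap(2)[of i w] endomorphism_0[OF lin_u] by simp
    then have "(g ^^ m) ((u ^^ (k + m)) ((g ^^ m) y)) = 0"
      unfolding diff using b(1) c by (simp add: endomorphism_diff[OF lin_g])
    then have "(u ^^ (k + m)) ((g ^^ m) y) = 0"
      by (rule inj[rotated]) (simp add: swap)
    then have "(v ^^ (p + m)) a = (u ^^ (k + m)) c"
      using diff b by simp
    then show ?thesis
      using funpow_add_in_range[OF v g(1) comm_g(2) c, of k] eqs(1) by auto
  qed
  have "v ` range (g ^^ m) \<subseteq> range (g ^^ m)"
    using swap(1)[of 1] by auto
  then obtain q where q: "\<And>k. (v ^^ q) ` range (g ^^ m) \<subseteq> (v ^^ k) ` range (g ^^ m)"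
    using ranges_stabilize_finite_dim[OF v endomorphism_subspace_image[OF lin_g subspace_UNIV]]
      fin rank(2) by metis
  have sub: "subspace (range (v ^^ k))" for k
    by (rule endomorphism_subspace_image[OF lin_v subspace_UNIV])
  have mono: "(v ^^ i) w \<in> range (v ^^ k)" if "w \<in> range (v ^^ k)" for i k w
    using that funpow_commute[of v v i k] by auto
  have "(v ^^ (p + m + q)) x \<in> range (v ^^ k)" for k x
  proof -
    obtain y where y: "(g ^^ m) (x - (g ^^ m) y) = 0"
      using ex by blast
    define b where "b = (g ^^ m) y"
    have "(v ^^ (q + (p + m))) (x - b) \<in> range (v ^^ k)"
      unfolding funpow_add_apply[of q] by (rule mono, rule nil) (use y in \<open>simp add: b_def\<close>)
    moreover have "(v ^^ (p + m + q)) b \<in> range (v ^^ k)"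
      unfolding funpow_add_apply[of "p + m"] by (rule mono) (use q[of k] in \<open>unfold b_def, blast\<close>)
    ultimately have "(v ^^ (q + (p + m))) (x - b) + (v ^^ (p + m + q)) b \<in> range (v ^^ k)"
      by (rule subspace_add[OF sub])
    then show ?thesis
      by (simp add: endomorphism_diff[OF lin_v] add.commute)
  qed
  then show ?thesis
    unfolding finite_descent_def by blast
qed

end

end

section \<open>Drazin invertibility of an operator in terms of its resolvent\<close>

text \<open>A set of naturals has infinite infimum in \<open>enat\<close> only if it is
  empty.\<close>

lemma drazin_invertible_iff:
  "drazin_invertible S \<longleftrightarrow>
     (\<exists>n. null_space (pow_op S n) = null_space (pow_op S (Suc n))) \<and>
     (\<exists>n. range_space (pow_op S n) = range_space (pow_op S (Suc n)))"
proof -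
  have *: "Inf (enat ` N) \<noteq> \<infinity> \<longleftrightarrow> (\<exists>n. n \<in> N)" for N
  proof
    assume "\<exists>n. n \<in> N"
    then obtain n where "n \<in> N" ..
    then have "Inf (enat ` N) \<le> enat n"
      by (rule INF_lower)
    then show "Inf (enat ` N) \<noteq> \<infinity>"
      using enat_ile by fastforce
  qed (auto simp: top_enat_def ex_in_conv)
  show ?thesis
    unfolding drazin_invertible_def ascent_def descent_def * mem_Collect_eq ..
qed

locale op_with_resolvent =
  fixes T :: "'a::complex_banach lop" and c :: complex
  assumes linear_op: "linear_op T" and resolvent: "c \<in> resolvent_set T"
begin

abbreviation R :: "'a \<Rightarrow> 'a" where
  "R \<equiv> resolvent_op c T"

lemma bij: "bij_betw (\<lambda>x. c *\<^sub>C x - app T x) (dom_of T) UNIV"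
  using resolvent by (simp add: resolvent_set_def)

lemma R_in_dom: "R y \<in> dom_of T"
  using bij unfolding resolvent_op_def by (metis UNIV_I bij_betw_def inv_into_into)

lemma app_R: "app T (R y) = c *\<^sub>C R y - y"
proof -
  have "c *\<^sub>C R y - app T (R y) = y"
    using bij f_inv_into_f[of y "\<lambda>x. c *\<^sub>C x - app T x" "dom_of T"]
    unfolding resolvent_op_def bij_betw_def by simp
  then show ?thesis
    by (simp add: algebra_simps)
qed

lemma R_eqI: "x \<in> dom_of T \<Longrightarrow> c *\<^sub>C x - app T x = y \<Longrightarrow> R y = x"
  unfolding resolvent_op_def using bij by (intro inv_into_f_eq) (auto simp: bij_betw_def)

lemma dom_eq: "dom_of T = range R"
proof
  show "dom_of T \<subseteq> range R"
    using R_eqI[OF _ refl] by (metis rangeI subsetI)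
qed (use R_in_dom in auto)

lemma R_inj:
  assumes "R x = R y"
  shows "x = y"
proof -
  have "c *\<^sub>C R y - x = c *\<^sub>C R y - y"
    using app_R[of x] app_R[of y] unfolding assms by (rule trans[OF sym])
  then show ?thesis
    by simp
qed

lemma R_linear: "endomorphism scaleC R"
  unfolding complex_vector.endomorphism_iff
proof (intro conjI allI)
  fix x y
  show "R (x + y) = R x + R y"
    using linear_op R_in_dom[of x] R_in_dom[of y]
    by (intro R_eqI)
      (simp_all add: linear_op_def complex_vector.subspace_add app_R scaleC_add_right)
next
  fix a x
  show "R (a *\<^sub>C x) = a *\<^sub>C R x"
    using linear_op R_in_dom[of x]
    by (intro R_eqI)
      (simp_all add: linear_op_def complex_vector.subspace_scale app_R
        complex_vector.scale_right_diff_distrib scaleC_scaleC mult.commute)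
qed

text \<open>The point \<open>l\<close> for \<open>T\<close> corresponds to
  \<open>inverse (c - l)\<close> for the resolvent. The point \<open>l = c\<close>, where
  \<open>inverse 0 = 0\<close> makes this map \<open>R\<close>, is settled by
  \<open>drazin_invertible_shift_resolvent\<close>.\<close>

definition shifted :: "complex \<Rightarrow> 'a \<Rightarrow> 'a" where
  "shifted l x = R x - inverse (c - l) *\<^sub>C x"

lemma shifted_linear: "endomorphism scaleC (shifted l)"
  using R_linear
  by (auto simp: complex_vector.endomorphism_iff shifted_def scaleC_add_right scaleC_scaleC
      complex_vector.scale_right_diff_distrib mult.commute)

lemma shifted_R: "shifted l (R x) = R (shifted l x)"
  using R_linear
  by (simp add: shifted_def complex_vector.endomorphism_diff[OF R_linear] complex_vector.endomorphism_iff)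

context
  fixes l :: complex
  assumes l: "l \<noteq> c"
begin

abbreviation V :: "'a \<Rightarrow> 'a" where "V \<equiv> shifted l"

lemma V_pow_R_pow: "(V ^^ i) ((R ^^ j) x) = (R ^^ j) ((V ^^ i) x)"
  by (rule funpow_commute) (rule shifted_R)

lemmas R_pow_linear = complex_vector.endomorphism_funpow[OF R_linear]
lemmas V_pow_linear = complex_vector.endomorphism_funpow[OF shifted_linear]

text \<open>This is the factorization of \<open>T - l I\<close> through \<open>c I - T\<close>, with
  the domain parametrized by \<open>R\<close>.\<close>

lemma shift_app_R: "app (shift_op T l) (R y) = (c - l) *\<^sub>C V y"
proof -
  have "(c - l) *\<^sub>C V y = (c - l) *\<^sub>C R y - y"
    using l[symmetric]
    by (simp add: shifted_def complex_vector.scale_right_diff_distrib scaleC_scaleC scaleC_one)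
  then show ?thesis
    by (simp add: shift_op_def app_R complex_vector.scale_left_diff_distrib)
qed

lemma eq_R_minus_V: "x = (c - l) *\<^sub>C (R x - V x)"
  using l[symmetric] by (simp add: shifted_def scaleC_scaleC scaleC_one)

text \<open>Since $x$ is a multiple of $Rx - Vx$, it is at least as regular as $Vx$.\<close>

lemma range_R_if_V: "V x \<in> range (R ^^ j) \<Longrightarrow> x \<in> range (R ^^ j)"
proof (induction j)
  case (Suc j)
  have "V x \<in> range (R ^^ j)"
    using Suc.prems by (auto simp: funpow_swap1)
  then obtain y where y: "x = (R ^^ j) y"
    using Suc.IH by blast
  have "R x \<in> range (R ^^ Suc j)"
    by (auto simp: y)
  then show ?case
    using Suc.prems eq_R_minus_V[of x]
      complex_vector.endomorphism_subspace_image[OF R_pow_linear[of "Suc j"] complex_vector.subspace_UNIV]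
    by (metis complex_vector.subspace_diff complex_vector.subspace_scale)
qed simp

lemma range_R_if_V_pow: "(V ^^ n) x \<in> range (R ^^ j) \<Longrightarrow> x \<in> range (R ^^ j)"
proof (induction n)
  case (Suc n)
  then show ?case
    using range_R_if_V[of "(V ^^ n) x" j] by simp
qed simp

text \<open>Domain and values go through one induction because the natural domain of each power
  depends on the values of the preceding one.\<close>

lemma pow_shift:
  "dom_of (pow_op (shift_op T l) n) = range (R ^^ n) \<and>
   (\<forall>y. app (pow_op (shift_op T l) n) ((R ^^ n) y) = (c - l) ^ n *\<^sub>C (V ^^ n) y)"
proof (induction n)
  case 0
  then show ?case by (simp add: scaleC_one)
next
  case (Suc n)
  let ?S = "shift_op T l"
  have dom: "dom_of ?S = range R"
    by (simp add: shift_op_def dom_eq)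
  have sub: "complex_vector.subspace (range R)"
    by (rule complex_vector.endomorphism_subspace_image[OF R_linear complex_vector.subspace_UNIV])
  have app: "app (pow_op ?S n) ((R ^^ Suc n) y) = R ((c - l) ^ n *\<^sub>C (V ^^ n) y)" for y
  proof -
    have "app (pow_op ?S n) ((R ^^ n) (R y)) = (c - l) ^ n *\<^sub>C (V ^^ n) (R y)"
      using Suc by blast
    also have "(V ^^ n) (R y) = R ((V ^^ n) y)"
      using V_pow_R_pow[of n 1 y] by simp
    finally show ?thesis
      using R_linear by (simp add: funpow_swap1 complex_vector.endomorphism_iff)
  qed
  \<comment> \<open>The value is a nonzero multiple of \<open>(V ^^ n) y\<close>, and
    \<open>V\<close> cannot create regularity: if \<open>(V ^^ n) y\<close> is in the range of
    \<open>R\<close>, so is \<open>y\<close>.\<close>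
  have "app (pow_op ?S n) ((R ^^ n) y) \<in> range R \<longleftrightarrow> y \<in> range R" for y
  proof
    assume "app (pow_op ?S n) ((R ^^ n) y) \<in> range R"
    then have "inverse ((c - l) ^ n) *\<^sub>C (c - l) ^ n *\<^sub>C (V ^^ n) y \<in> range R"
      using Suc by (metis complex_vector.subspace_scale[OF sub])
    then have "(V ^^ n) y \<in> range R"
      using l[symmetric] by (simp add: scaleC_scaleC scaleC_one)
    then show "y \<in> range R"
      using range_R_if_V_pow[of n y 1] by simp
  next
    assume "y \<in> range R"
    then show "app (pow_op ?S n) ((R ^^ n) y) \<in> range R"
      using app by (auto simp: funpow_swap1)
  qed
  then have "{x \<in> range (R ^^ n). app (pow_op ?S n) x \<in> range R} = (R ^^ n) ` range R"
    by blast
  moreover have "dom_of (pow_op ?S (Suc n)) = {x \<in> range (R ^^ n). app (pow_op ?S n) x \<in> range R}"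
    using Suc by (simp add: dom)
  ultimately have "dom_of (pow_op ?S (Suc n)) = range (R ^^ Suc n)"
    unfolding funpow_Suc_right by (simp only: image_comp)
  moreover have "app (pow_op ?S (Suc n)) ((R ^^ Suc n) y) = (c - l) ^ Suc n *\<^sub>C (V ^^ Suc n) y" for y
    unfolding pow_op.simps lop.sel app shift_app_R
    using shifted_linear[of l] by (simp add: complex_vector.endomorphism_iff scaleC_scaleC)
  ultimately show ?case
    by blast
qed

text \<open>A zero of \<open>V ^^ n\<close> lies in the domain automatically, since 0 is in the
  range of \<open>R ^^ n\<close> and \<open>range_R_if_V_pow\<close> pulls this back. On the domain,
  commutation with \<open>R ^^ n\<close> and its injectivity identify the two kernels.\<close>

lemma null_space_pow_shift: "null_space (pow_op (shift_op T l) n) = {x. (V ^^ n) x = 0}"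
proof -
  have eq0: "(c - l) ^ n *\<^sub>C y = 0 \<longleftrightarrow> y = 0" for y :: 'a
    using l[symmetric] by (simp add: complex_vector.scale_eq_0_iff)
  have inj: "(R ^^ n) y = 0 \<longleftrightarrow> y = 0" for y
  proof (induction n)
    case (Suc n)
    then show ?case
      using R_inj[of "(R ^^ n) y" 0] complex_vector.endomorphism_0[OF R_linear] by auto
  qed simp
  have "x \<in> range (R ^^ n)" if "(V ^^ n) x = 0" for x
    using that range_R_if_V_pow[of n x n] complex_vector.endomorphism_0[OF R_pow_linear]
    by (metis rangeI)
  moreover have "app (pow_op (shift_op T l) n) x = 0 \<longleftrightarrow> (V ^^ n) x = 0"
    if "x \<in> range (R ^^ n)" for x
  proof -
    from that obtain y where y: "x = (R ^^ n) y"
      by blast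
    then have "app (pow_op (shift_op T l) n) x = (c - l) ^ n *\<^sub>C (V ^^ n) y"
      using pow_shift[of n] by blast
    then show ?thesis
      unfolding y V_pow_R_pow by (simp only: eq0 inj)
  qed
  ultimately show ?thesis
    using pow_shift[of n] unfolding null_space_def by blast
qed

text \<open>The nonzero scalar moves inside \<open>V ^^ n\<close> by linearity, where scaling is
  onto.\<close>

lemma range_space_pow_shift: "range_space (pow_op (shift_op T l) n) = range (V ^^ n)"
proof -
  have "range_space (pow_op (shift_op T l) n) = range (\<lambda>y. (c - l) ^ n *\<^sub>C (V ^^ n) y)"
    using pow_shift[of n] by (simp add: range_space_def image_image)
  also have "\<dots> = range (\<lambda>y. (V ^^ n) ((c - l) ^ n *\<^sub>C y))"
    using V_pow_linear[of n l] by (simp add: complex_vector.endomorphism_iff)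
  also have "\<dots> = (V ^^ n) ` range (\<lambda>y. (c - l) ^ n *\<^sub>C y)"
    by (simp add: image_image)
  also have "range (\<lambda>y::'a. (c - l) ^ n *\<^sub>C y) = UNIV"
    using l[symmetric] by (intro surjI[of _ "\<lambda>y. inverse ((c - l) ^ n) *\<^sub>C y"]) (simp add: scaleC_scaleC scaleC_one)
  finally show ?thesis .
qed

lemma drazin_invertible_shift_iff:
  "drazin_invertible (shift_op T l) \<longleftrightarrow> finite_ascent V \<and> finite_descent V"
  unfolding drazin_invertible_iff null_space_pow_shift range_space_pow_shift finite_descent_iff
    finite_ascent_iff[of V, OF complex_vector.endomorphism_0[OF shifted_linear]] ..

end

text \<open>\<open>T - c I\<close> maps its domain bijectively onto the space, so ascent and descent
  are both 0.\<close>

lemma drazin_invertible_shift_resolvent: "drazin_invertible (shift_op T c)"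
proof -
  have app: "app (shift_op T c) (R y) = - y" for y
    by (simp add: shift_op_def app_R)
  have dom: "dom_of (shift_op T c) = range R"
    by (simp add: shift_op_def dom_eq)
  have "null_space (pow_op (shift_op T c) 0) = null_space (pow_op (shift_op T c) 1)"
    using complex_vector.endomorphism_0[OF R_linear] app[of 0]
    by (auto simp: null_space_def dom app)
  moreover have "range_space (pow_op (shift_op T c) 0) = range_space (pow_op (shift_op T c) 1)"
    by (simp add: range_space_def dom app image_image)
  ultimately show ?thesis
    unfolding drazin_invertible_iff by (metis One_nat_def)
qed

end

section \<open>Commuting resolvents and comparison of the two operators\<close>

text \<open>On the resolvent set Drazin invertibility is automatic, so the requirement on spectral
  points extends to every \<open>l\<close>.\<close>

lemma purely_b_discrete_iff:
  assumes "linear_op T"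
  shows "purely_b_discrete T \<longleftrightarrow> (\<forall>l. drazin_invertible (shift_op T l))"
  using op_with_resolvent.drazin_invertible_shift_resolvent[OF op_with_resolvent.intro[OF assms]]
  by (auto simp: purely_b_discrete_def b_discrete_spectrum_def drazin_spectrum_def spectrum_op_def)

lemma linear_op_lincomb:
  assumes "linear_op S" "x \<in> dom_of S" "y \<in> dom_of S"
  shows "a *\<^sub>C x - y \<in> dom_of S" "app S (a *\<^sub>C x - y) = a *\<^sub>C app S x - app S y"
proof -
  have sub: "complex_vector.subspace (dom_of S)"
    using assms by (simp add: linear_op_def)
  have ax: "a *\<^sub>C x \<in> dom_of S"
    by (rule complex_vector.subspace_scale[OF sub assms(2)])
  show d: "a *\<^sub>C x - y \<in> dom_of S"
    by (rule complex_vector.subspace_diff[OF sub ax assms(3)])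
  have "app S (a *\<^sub>C x - y + y) = app S (a *\<^sub>C x - y) + app S y"
    using assms d unfolding linear_op_def by blast
  moreover have "app S (a *\<^sub>C x) = a *\<^sub>C app S x"
    using assms unfolding linear_op_def by blast
  ultimately show "app S (a *\<^sub>C x - y) = a *\<^sub>C app S x - app S y"
    by (simp add: eq_diff_eq)
qed

text \<open>For \<open>x\<close> the left-hand side, \<open>c I - A\<close> and
  \<open>c I - T\<close> may be applied in either order with result \<open>y\<close>, once the
  domain conditions in \<open>commutes\<close> are verified; inverting in the other order returns
  \<open>x\<close>.\<close>

lemma resolvent_op_commute:
  assumes "linear_op A" "linear_op T" "commutes A T" "c \<in> resolvent_set A" "c \<in> resolvent_set T"
  shows "resolvent_op c A (resolvent_op c T y) = resolvent_op c T (resolvent_op c A y)"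
proof -
  interpret A: op_with_resolvent A c using assms by unfold_locales
  interpret T: op_with_resolvent T c using assms by unfold_locales
  define w where "w = T.R y"
  define x where "x = A.R w"
  have x: "x \<in> dom_of A" "x \<in> dom_of T" "app A x = c *\<^sub>C x - w"
    using A.R_in_dom[of w] assms(3) A.app_R[of w] by (auto simp: x_def commutes_def)
  have w: "w \<in> dom_of T" "app T w = c *\<^sub>C w - y"
    using T.R_in_dom[of y] T.app_R[of y] by (auto simp: w_def)
  \<comment> \<open>This is the side condition for \<open>A T x = T A x\<close>; it holds because
    \<open>x\<close> and \<open>w\<close> are both in the domain of \<open>T\<close>.\<close>
  have Ax: "app A x \<in> dom_of T"
    unfolding x(3) by (rule linear_op_lincomb[OF assms(2) x(2) w(1)])
  have Tx: "app T x \<in> dom_of A" "app A (app T x) = app T (app A x)"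
    using x(1) Ax assms(3) by (auto simp: commutes_def)
  have "app A (c *\<^sub>C x - app T x) = c *\<^sub>C app A x - app T (app A x)"
    using linear_op_lincomb(2)[OF assms(1) x(1) Tx(1)] Tx(2) by simp
  also have "app T (app A x) = c *\<^sub>C app T x - app T w"
    unfolding x(3) by (rule linear_op_lincomb[OF assms(2) x(2) w(1)])
  also have "c *\<^sub>C app A x - \<dots> = c *\<^sub>C (c *\<^sub>C x - app T x) - y"
    unfolding x(3) w(2) complex_vector.scale_right_diff_distrib by simp
  \<comment> \<open>The computation says that \<open>c I - A\<close> sends \<open>c x - T x\<close>
    to \<open>y\<close>.\<close>
  finally have "A.R y = c *\<^sub>C x - app T x"
    using linear_op_lincomb(1)[OF assms(1) x(1) Tx(1)] by (intro A.R_eqI) auto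
  then have "T.R (A.R y) = x"
    using x by (intro T.R_eqI) auto
  then show ?thesis
    by (simp add: x_def w_def)
qed

theorem theorem3p4:
  fixes A T :: "'a::complex_banach lop"
  assumes "closed_op A" and "closed_op T"
    and "commutes A T"
    and "\<exists>c \<in> resolvent_set A \<inter> resolvent_set T.
           has_finite_rank_power (\<lambda>x. resolvent_op c A x - resolvent_op c T x)"
  shows "purely_b_discrete A \<longleftrightarrow> purely_b_discrete T"
proof -
  have lin: "linear_op A" "linear_op T"
    using assms by (auto simp: closed_op_def)
  obtain c n B where c: "c \<in> resolvent_set A" "c \<in> resolvent_set T"
    and B: "finite B" "range ((\<lambda>x. resolvent_op c A x - resolvent_op c T x) ^^ n) \<subseteq> complex_vector.span B"
    using assms(4) by (auto simp: has_finite_rank_power_def finite_rank_def)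
  interpret A: op_with_resolvent A c using lin c by unfold_locales
  interpret T: op_with_resolvent T c using lin c by unfold_locales
  have "drazin_invertible (shift_op A l) \<longleftrightarrow> drazin_invertible (shift_op T l)" for l
  proof (cases "l = c")
    case True
    then show ?thesis
      using A.drazin_invertible_shift_resolvent T.drazin_invertible_shift_resolvent by simp
  next
    case False
    let ?u = "A.shifted l" and ?v = "T.shifted l"
    have comm: "?u (?v x) = ?v (?u x)" for x
      using resolvent_op_commute[OF lin assms(3) c] A.R_linear T.R_linear
      by (simp add: A.shifted_def T.shifted_def complex_vector.endomorphism_diff
          complex_vector.endomorphism_iff complex_vector.scale_right_diff_distrib algebra_simps)
    \<comment> \<open>The scalar terms of the two shifts cancel, so \<open>?u - ?v\<close> is the
      difference of the resolvents for every \<open>l\<close>.\<close>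
    have rank: "range ((\<lambda>x. ?u x - ?v x) ^^ n) \<subseteq> complex_vector.span B"
      using B(2) by (simp add: A.shifted_def T.shifted_def)
    \<comment> \<open>The perturbation lemmas lead from \<open>u\<close> to \<open>v\<close> only;
      the converse swaps the maps, which changes the sign of the difference.\<close>
    have "endomorphism scaleC (\<lambda>x. ?u x - ?v x)"
      using A.shifted_linear[of l] T.shifted_linear[of l]
      by (auto simp: complex_vector.endomorphism_iff complex_vector.scale_right_diff_distrib)
    from complex_vector.funpow_uminus[OF this, of n]
    have pm: "((\<lambda>x. ?v x - ?u x) ^^ n) x = ((\<lambda>x. ?u x - ?v x) ^^ n) x \<or>
        ((\<lambda>x. ?v x - ?u x) ^^ n) x = - ((\<lambda>x. ?u x - ?v x) ^^ n) x" for x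
      by simp
    have rank': "range ((\<lambda>x. ?v x - ?u x) ^^ n) \<subseteq> complex_vector.span B"
    proof (rule image_subsetI)
      fix x
      have "((\<lambda>x. ?u x - ?v x) ^^ n) x \<in> complex_vector.span B"
        using rank by blast
      then show "((\<lambda>x. ?v x - ?u x) ^^ n) x \<in> complex_vector.span B"
        using pm[of x] by (elim disjE) (simp_all only: complex_vector.span_neg)
    qed
    show ?thesis
      unfolding A.drazin_invertible_shift_iff[OF False] T.drazin_invertible_shift_iff[OF False]
      using complex_vector.finite_ascent_finite_rank_perturbation
        [OF A.shifted_linear T.shifted_linear comm rank B(1)]
        complex_vector.finite_descent_finite_rank_perturbation
        [OF A.shifted_linear T.shifted_linear comm rank B(1)]
        complex_vector.finite_ascent_finite_rank_perturbation
        [OF T.shifted_linear A.shifted_linear comm[symmetric] rank' B(1)]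
        complex_vector.finite_descent_finite_rank_perturbation
        [OF T.shifted_linear A.shifted_linear comm[symmetric] rank' B(1)]
      by blast
  qed
  then show ?thesis
    by (simp add: purely_b_discrete_iff[OF lin(1)] purely_b_discrete_iff[OF lin(2)])
qed

end
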